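(* If $A\lor B$ is provable in $\mathsf{BT}^{i}$, then $A$ is provable in $\mathsf{BT}^{i}$ or $B$ is provable in $\mathsf{BT}^{i}$.
   Context: Formulae are generated from a countable set of propositional variables by $A ::= p \mid \bot \mid A\land A \mid A\lor A \mid A\to A$. Blocks. A signed formula is $\mathsf{T}A$ or $\mathsf{F}A$; a block is a finite set $\Pi$ of signed formulae; $\Pi^{\mathsf{T}}=\{\mathsf{T}A:\mathsf{T}A\in\Pi\}$. The calculus $\mathsf{BT}^{i}$. A block is closed if it contains $\mathsf{T}p$ and $\mathsf{F}p$ for some propositional variable $p$, or contains $\mathsf{T}\bot$. The rules pass from a block (context $\Pi$ plus displayed principal formula, which is removed unless displayed again) to one or two children: - $\mathsf{T}\land$: from $\Pi,\mathsf{T}(A\land B)$ to $\Pi,\mathsf{T}A,\mathsf{T}B$. - $\mathsf{F}\lor$: from $\Pi,\mathsf{F}(A\lor B)$ to $\Pi,\mathsf{F}A,\mathsf{F}B$. - $\mathsf{T}\lor$: from $\Pi,\mathsf{T}(A\lor B)$ to two children $\Pi,\mathsf{T}A$ and $\Pi,\mathsf{T}B$. - $\mathsf{F}\land$: from $\Pi,\mathsf{F}(A\land B)$ to two children $\Pi,\mathsf{F}A$ and $\Pi,\mathsf{F}B$. - $\mathsf{T}\to$: from $\Pi,\mathsf{T}(A\to B)$ to two children $\Pi,\mathsf{T}(A\to B),\mathsf{F}A$ and $\Pi,\mathsf{T}B$. - $\mathsf{F}\to$: from $\Pi,\mathsf{F}(A\to B)$ to $\Pi^{\mathsf{T}},\mathsf{T}A,\mathsf{F}B$.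 A tableau for $\Pi$ is a finite tree rooted at $\Pi$ grown by these rules; it is closed if every leaf is a closed block. $\Pi$ is refutable if it has a closed tableau. A formula $A$ is provable in $\mathsf{BT}^{i}$ if the block $\{\mathsf{F}A\}$ is refutable. *)

theory Defs
  imports "HOL-Library.FSet" "HOL-Library.Countable"
begin

datatype 'v form =
    Var 'v
  | Bot ("\<^bold>\<bottom>")
  | And "'v form" "'v form" (infixr "\<^bold>\<and>" 75)
  | Or "'v form" "'v form" (infixr "\<^bold>\<or>" 70)
  | Imp "'v form" "'v form" (infixr "\<^bold>\<rightarrow>" 65)

datatype 'v sform = T "'v form" | F "'v form"

type_synonym 'v block = "'v sform fset"

definition Tpart :: "'v block \<Rightarrow> 'v block" where
  "Tpart \<Pi> = ffilter (\<lambda>\<phi>. \<exists>A. \<phi> = T A) \<Pi>"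

definition closed_block :: "'v block \<Rightarrow> bool" where
  "closed_block \<Pi> \<longleftrightarrow> (\<exists>p. T (Var p) |\<in>| \<Pi> \<and> F (Var p) |\<in>| \<Pi>) \<or> T \<^bold>\<bottom> |\<in>| \<Pi>"

text \<open>
  \<open>rule \<Pi> \<Pi>s\<close>: one rule application leads from \<open>\<Pi>\<close> to the children \<open>\<Pi>s\<close>. Blocks are sets, so the
  side condition that the principal formula is not in the context expresses that it is removed
  from the children unless the rule displays it again.
\<close>
inductive rule :: "'v block \<Rightarrow> 'v block list \<Rightarrow> bool" where
  T_And: "T (A \<^bold>\<and> B) |\<notin>| \<Pi> \<Longrightarrow>
    rule (finsert (T (A \<^bold>\<and> B)) \<Pi>) [finsert (T A) (finsert (T B) \<Pi>)]"
| F_Or: "F (A \<^bold>\<or> B) |\<notin>| \<Pi> \<Longrightarrow>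
    rule (finsert (F (A \<^bold>\<or> B)) \<Pi>) [finsert (F A) (finsert (F B) \<Pi>)]"
| T_Or: "T (A \<^bold>\<or> B) |\<notin>| \<Pi> \<Longrightarrow>
    rule (finsert (T (A \<^bold>\<or> B)) \<Pi>) [finsert (T A) \<Pi>, finsert (T B) \<Pi>]"
| F_And: "F (A \<^bold>\<and> B) |\<notin>| \<Pi> \<Longrightarrow>
    rule (finsert (F (A \<^bold>\<and> B)) \<Pi>) [finsert (F A) \<Pi>, finsert (F B) \<Pi>]"
| T_Imp: "T (A \<^bold>\<rightarrow> B) |\<notin>| \<Pi> \<Longrightarrow>
    rule (finsert (T (A \<^bold>\<rightarrow> B)) \<Pi>)
      [finsert (T (A \<^bold>\<rightarrow> B)) (finsert (F A) \<Pi>), finsert (T B) \<Pi>]"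
| F_Imp: "F (A \<^bold>\<rightarrow> B) |\<notin>| \<Pi> \<Longrightarrow>
    rule (finsert (F (A \<^bold>\<rightarrow> B)) \<Pi>) [finsert (T A) (finsert (F B) (Tpart \<Pi>))]"

datatype 'v tree = Node (root: "'v block") (subtrees: "'v tree list")

inductive tableau :: "'v tree \<Rightarrow> bool" where
  leaf: "tableau (Node \<Pi> [])"
| step: "rule \<Pi> (map root ts) \<Longrightarrow> (\<And>t. t \<in> set ts \<Longrightarrow> tableau t) \<Longrightarrow> tableau (Node \<Pi> ts)"

definition tableau_for :: "'v block \<Rightarrow> 'v tree \<Rightarrow> bool" where
  "tableau_for \<Pi> t \<longleftrightarrow> tableau t \<and> root t = \<Pi>"

fun leaves :: "'v tree \<Rightarrow> 'v block set" where
  "leaves (Node \<Pi> ts) = (if ts = [] then {\<Pi>} else (\<Union>t\<in>set ts. leaves t))"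

definition closed_tableau :: "'v tree \<Rightarrow> bool" where
  "closed_tableau t \<longleftrightarrow> (\<forall>\<Pi>\<in>leaves t. closed_block \<Pi>)"

definition refutable :: "'v block \<Rightarrow> bool" where
  "refutable \<Pi> \<longleftrightarrow> (\<exists>t. tableau_for \<Pi> t \<and> closed_tableau t)"

definition provable :: "'v form \<Rightarrow> bool" where
  "provable A \<longleftrightarrow> refutable {|F A|}"

end

theory Submission
  imports Defs
begin

text \<open>
  Refuting a block without \<open>T\<close>-formulae amounts to proving the disjunction of its
  \<open>F\<close>-formulae, and it succeeds only if already one of these formulae can be refuted alone
  (\<open>refutable_F_block_imp_singleton\<close>). Indeed such a block is never closed, and no \<open>T\<close>-rule
  applies to it. The rules for \<open>F (A \<^bold>\<and> B)\<close> and \<open>F (A \<^bold>\<or> B)\<close> produce \<open>T\<close>-free blocks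
  again, so that induction on the closed tableau supplies refutable members of the children, from
  which a refutable member of the parent is rebuilt. The rule for \<open>F (A \<^bold>\<rightarrow> B)\<close> does
  create a \<open>T\<close>-formula, but it discards every other \<open>F\<close>-formula: its child depends on the
  principal formula alone, which therefore is already refutable by itself.

  The disjunction property follows, because the only tableau step from \<open>{|F (A \<^bold>\<or> B)|}\<close> leads
  to the \<open>T\<close>-free block \<open>{|F A, F B|}\<close>.

  The one structural property needed is weakening (\<open>refutable_mono\<close>): for a block
  \<open>\<Pi>, F (A \<^bold>\<or> B)\<close> the induction may yield, say, that \<open>{|F A|}\<close> is refutable, whereas the
  tableau for \<open>{|F (A \<^bold>\<or> B)|}\<close> has to continue with \<open>{|F A, F B|}\<close>.
\<close>

lemma refutable_closed_block: "closed_block \<Pi> \<Longrightarrow> refutable \<Pi>"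
  unfolding refutable_def
  by (rule exI[of _ "Node \<Pi> []"])
    (auto simp: tableau_for_def closed_tableau_def intro: tableau.leaf)

lemma refutable_rule:
  assumes "rule \<Pi> \<Pi>s" and "\<And>\<Pi>'. \<Pi>' \<in> set \<Pi>s \<Longrightarrow> refutable \<Pi>'"
  shows "refutable \<Pi>"
proof -
  obtain f where f: "\<And>\<Pi>'. \<Pi>' \<in> set \<Pi>s \<Longrightarrow> tableau_for \<Pi>' (f \<Pi>') \<and> closed_tableau (f \<Pi>')"
    using assms(2) unfolding refutable_def by metis
  have "map root (map f \<Pi>s) = \<Pi>s"
    using f by (auto simp: tableau_for_def intro!: map_idI)
  then have "tableau (Node \<Pi> (map f \<Pi>s))"
    using assms(1) f by (intro tableau.step) (auto simp: tableau_for_def)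
  moreover have "\<Pi>s \<noteq> []"
    using assms(1) by (auto elim: rule.cases)
  ultimately show ?thesis
    using f unfolding refutable_def
    by (intro exI[of _ "Node \<Pi> (map f \<Pi>s)"]) (auto simp: tableau_for_def closed_tableau_def)
qed

text \<open>
  Together with the two lemmas above, this replaces tableau trees by an inductive view of
  refutability: it is the least property of blocks that contains the closed ones and is
  propagated from the children of a rule application to the parent.
\<close>

lemma refutable_induct [consumes 1, case_names closed rule]:
  assumes "refutable \<Pi>"
    and closed: "\<And>\<Pi>. closed_block \<Pi> \<Longrightarrow> P \<Pi>"
    and rule: "\<And>\<Pi> \<Pi>s. rule \<Pi> \<Pi>s \<Longrightarrow> (\<And>\<Pi>'. \<Pi>' \<in> set \<Pi>s \<Longrightarrow> refutable \<Pi>') \<Longrightarrow>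
      (\<And>\<Pi>'. \<Pi>' \<in> set \<Pi>s \<Longrightarrow> P \<Pi>') \<Longrightarrow> P \<Pi>"
  shows "P \<Pi>"
proof -
  have "P (root t)" if "tableau t" "closed_tableau t" for t
    using that
  proof (induction rule: tableau.induct)
    case (leaf \<Pi>)
    then show ?case by (auto simp: closed_tableau_def intro: closed)
  next
    case (step \<Pi> ts)
    have "closed_tableau t" if "t \<in> set ts" for t
      using that step.prems by (auto simp: closed_tableau_def split: if_splits)
    then have "refutable \<Pi>' \<and> P \<Pi>'" if "\<Pi>' \<in> set (map root ts)" for \<Pi>'
      using that step.hyps(2) step.IH by (auto simp: refutable_def tableau_for_def)
    then show ?case
      using rule[OF step.hyps(1)] unfolding tree.sel by blast
  qed
  then show ?thesis
    using assms(1) by (auto simp: refutable_def tableau_for_def)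
qed

text \<open>
  Weakening one rule application. If the principal formula of the smaller block also belongs to
  what is added, it is removed from the larger block as well, so the larger child is not the
  smaller child plus the added formulae; but inclusion survives, which is all that is used.
\<close>

lemma rule_mono:
  assumes "rule \<Pi> \<Pi>s" and "\<Pi> |\<subseteq>| \<Delta>"
  obtains \<Delta>s where "rule \<Delta> \<Delta>s" and "\<forall>\<Delta>'\<in>set \<Delta>s. \<exists>\<Pi>'\<in>set \<Pi>s. \<Pi>' |\<subseteq>| \<Delta>'"
proof -
  have split: "\<exists>\<Gamma>. \<Delta> = finsert \<phi> \<Gamma> \<and> \<phi> |\<notin>| \<Gamma> \<and> \<Sigma> |\<subseteq>| \<Gamma>"
    if "finsert \<phi> \<Sigma> |\<subseteq>| \<Delta>" "\<phi> |\<notin>| \<Sigma>" for \<phi> \<Sigma>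
    using that by (intro exI[of _ "\<Delta> |-| {|\<phi>|}"]) auto
  have "\<exists>\<Delta>s. rule \<Delta> \<Delta>s \<and> (\<forall>\<Delta>'\<in>set \<Delta>s. \<exists>\<Pi>'\<in>set \<Pi>s. \<Pi>' |\<subseteq>| \<Delta>')"
    using assms
  proof (cases rule: rule.cases)
    case (T_And A B \<Sigma>)
    from split[OF assms(2)[unfolded T_And(1)] T_And(3)] obtain \<Gamma> where
      \<Gamma>: "\<Delta> = finsert (T (A \<^bold>\<and> B)) \<Gamma>" "T (A \<^bold>\<and> B) |\<notin>| \<Gamma>" "\<Sigma> |\<subseteq>| \<Gamma>"
      by blast
    show ?thesis
      unfolding \<Gamma>(1) T_And(2)
      by (rule exI, rule conjI[OF rule.T_And[OF \<Gamma>(2)]]) (use \<Gamma>(3) in auto)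
  next
    case (F_Or A B \<Sigma>)
    from split[OF assms(2)[unfolded F_Or(1)] F_Or(3)] obtain \<Gamma> where
      \<Gamma>: "\<Delta> = finsert (F (A \<^bold>\<or> B)) \<Gamma>" "F (A \<^bold>\<or> B) |\<notin>| \<Gamma>" "\<Sigma> |\<subseteq>| \<Gamma>"
      by blast
    show ?thesis
      unfolding \<Gamma>(1) F_Or(2)
      by (rule exI, rule conjI[OF rule.F_Or[OF \<Gamma>(2)]]) (use \<Gamma>(3) in auto)
  next
    case (T_Or A B \<Sigma>)
    from split[OF assms(2)[unfolded T_Or(1)] T_Or(3)] obtain \<Gamma> where
      \<Gamma>: "\<Delta> = finsert (T (A \<^bold>\<or> B)) \<Gamma>" "T (A \<^bold>\<or> B) |\<notin>| \<Gamma>" "\<Sigma> |\<subseteq>| \<Gamma>"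
      by blast
    show ?thesis
      unfolding \<Gamma>(1) T_Or(2)
      by (rule exI, rule conjI[OF rule.T_Or[OF \<Gamma>(2)]]) (use \<Gamma>(3) in auto)
  next
    case (F_And A B \<Sigma>)
    from split[OF assms(2)[unfolded F_And(1)] F_And(3)] obtain \<Gamma> where
      \<Gamma>: "\<Delta> = finsert (F (A \<^bold>\<and> B)) \<Gamma>" "F (A \<^bold>\<and> B) |\<notin>| \<Gamma>" "\<Sigma> |\<subseteq>| \<Gamma>"
      by blast
    show ?thesis
      unfolding \<Gamma>(1) F_And(2)
      by (rule exI, rule conjI[OF rule.F_And[OF \<Gamma>(2)]]) (use \<Gamma>(3) in auto)
  next
    case (T_Imp A B \<Sigma>)
    from split[OF assms(2)[unfolded T_Imp(1)] T_Imp(3)] obtain \<Gamma> where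
      \<Gamma>: "\<Delta> = finsert (T (A \<^bold>\<rightarrow> B)) \<Gamma>" "T (A \<^bold>\<rightarrow> B) |\<notin>| \<Gamma>" "\<Sigma> |\<subseteq>| \<Gamma>"
      by blast
    show ?thesis
      unfolding \<Gamma>(1) T_Imp(2)
      by (rule exI, rule conjI[OF rule.T_Imp[OF \<Gamma>(2)]]) (use \<Gamma>(3) in auto)
  next
    case (F_Imp A B \<Sigma>)
    from split[OF assms(2)[unfolded F_Imp(1)] F_Imp(3)] obtain \<Gamma> where
      \<Gamma>: "\<Delta> = finsert (F (A \<^bold>\<rightarrow> B)) \<Gamma>" "F (A \<^bold>\<rightarrow> B) |\<notin>| \<Gamma>" "\<Sigma> |\<subseteq>| \<Gamma>"
      by blast
    then have Tpart_mono: "Tpart \<Sigma> |\<subseteq>| Tpart \<Gamma>" by (auto simp: Tpart_def)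
    show ?thesis
      unfolding \<Gamma>(1) F_Imp(2)
      by (rule exI, rule conjI[OF rule.F_Imp[OF \<Gamma>(2)]]) (use \<Gamma>(3) Tpart_mono in auto)
  qed
  then show thesis using that by blast
qed

lemma refutable_mono:
  assumes "refutable \<Pi>" and "\<Pi> |\<subseteq>| \<Delta>"
  shows "refutable \<Delta>"
  using assms
proof (induction arbitrary: \<Delta> rule: refutable_induct)
  case (closed \<Pi>)
  then have "closed_block \<Delta>" by (auto simp: closed_block_def)
  then show ?case by (rule refutable_closed_block)
next
  case (rule \<Pi> \<Pi>s)
  from rule.hyps(1) rule.prems obtain \<Delta>s where
    "rule \<Delta> \<Delta>s" "\<forall>\<Delta>'\<in>set \<Delta>s. \<exists>\<Pi>'\<in>set \<Pi>s. \<Pi>' |\<subseteq>| \<Delta>'"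
    by (rule rule_mono)
  then show ?case
    using rule.IH by (blast intro: refutable_rule)
qed

lemma refutable_F_Or_iff: "refutable {|F (A \<^bold>\<or> B)|} \<longleftrightarrow> refutable {|F A, F B|}"
proof
  assume "refutable {|F (A \<^bold>\<or> B)|}"
  then show "refutable {|F A, F B|}"
  proof (induction "{|F (A \<^bold>\<or> B)|}" rule: refutable_induct)
    case closed
    then show ?case by (simp add: closed_block_def)
  next
    case (rule \<Pi>s)
    from rule(1) have "\<Pi>s = [{|F A, F B|}]"
      by (cases rule: rule.cases) auto
    then show ?case using rule(2) by simp
  qed
next
  assume "refutable {|F A, F B|}"
  then show "refutable {|F (A \<^bold>\<or> B)|}"
    by (intro refutable_rule[OF rule.F_Or]) auto
qed

text \<open>
  In the cases of \<open>F (A \<^bold>\<and> B)\<close> and \<open>F (A \<^bold>\<or> B)\<close>, the refutable member of a child found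
  by induction either lies in the context, hence in the parent, or is a component of the principal
  formula. If no context formula is found, the components found suffice to refute the principal
  formula on its own.
\<close>

lemma refutable_F_block_imp_singleton:
  assumes "refutable \<Pi>" and "\<And>A. T A |\<notin>| \<Pi>"
  shows "\<exists>\<phi>. \<phi> |\<in>| \<Pi> \<and> refutable {|\<phi>|}"
  using assms
proof (induction rule: refutable_induct)
  case (closed \<Pi>)
  then show ?case by (auto simp: closed_block_def)
next
  case (rule \<Pi> \<Pi>s)
  from rule.hyps(1) show ?case
  proof (cases rule: rule.cases)
    case (F_Or A B \<Sigma>)
    then obtain \<phi> where \<phi>: "\<phi> |\<in>| finsert (F A) (finsert (F B) \<Sigma>)" "refutable {|\<phi>|}"
      using rule.IH[of "finsert (F A) (finsert (F B) \<Sigma>)"] rule.prems by auto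
    show ?thesis
    proof (cases "\<phi> |\<in>| \<Sigma>")
      case True
      with \<phi> F_Or show ?thesis by auto
    next
      case False
      with \<phi> have "refutable {|F A, F B|}" by (auto elim: refutable_mono)
      then show ?thesis using F_Or refutable_F_Or_iff by blast
    qed
  next
    case (F_And A B \<Sigma>)
    then obtain \<phi> where \<phi>: "\<phi> |\<in>| finsert (F A) \<Sigma>" "refutable {|\<phi>|}"
      using rule.IH[of "finsert (F A) \<Sigma>"] rule.prems by auto
    from F_And obtain \<psi> where \<psi>: "\<psi> |\<in>| finsert (F B) \<Sigma>" "refutable {|\<psi>|}"
      using rule.IH[of "finsert (F B) \<Sigma>"] rule.prems by auto
    show ?thesis
    proof (cases "\<phi> |\<in>| \<Sigma> \<or> \<psi> |\<in>| \<Sigma>")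
      case True
      with \<phi> \<psi> F_And show ?thesis by auto
    next
      case False
      with \<phi> \<psi> have "refutable {|F A|}" "refutable {|F B|}" by auto
      then have "refutable {|F (A \<^bold>\<and> B)|}"
        by (intro refutable_rule[OF rule.F_And]) auto
      then show ?thesis using F_And by blast
    qed
  next
    case (F_Imp A B \<Sigma>)
    \<comment> \<open>Without \<open>T\<close>-formulae in the context, the child is the one that
      \<open>{|F (A \<^bold>\<rightarrow> B)|}\<close> has.\<close>
    have "Tpart \<Sigma> = Tpart {||}"
      using F_Imp rule.prems by (auto simp: Tpart_def)
    then have "refutable (finsert (T A) (finsert (F B) (Tpart {||})))"
      using F_Imp rule.hyps(2) by simp
    then have "refutable {|F (A \<^bold>\<rightarrow> B)|}"
      by (intro refutable_rule[OF rule.F_Imp]) auto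
    then show ?thesis using F_Imp by blast
  qed (use rule.prems in auto)
qed

theorem theorem5p13:
  fixes A B :: "'v :: countable form"
  assumes "provable (A \<^bold>\<or> B)"
  shows "provable A \<or> provable B"
proof -
  have "refutable {|F A, F B|}"
    using assms by (simp add: provable_def refutable_F_Or_iff)
  then have "\<exists>\<phi>. \<phi> |\<in>| {|F A, F B|} \<and> refutable {|\<phi>|}"
    by (rule refutable_F_block_imp_singleton) simp
  then show ?thesis
    by (auto simp: provable_def)
qed

end
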